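(* Let $X_1,X_2,\ldots$ be i.i.d. exponentially distributed random variables with density $\lambda e^{-\lambda x}$, $x\ge 0$, for some $\lambda>0$, and let $I_n^{(2)}$ be the statistic defined in the context. Then, as $n\to\infty$, $$\sqrt n\,I_n^{(2)}\ \xrightarrow{\ d\ }\ \mathcal N\left(0,\frac5{1512}\right).$$
   Context: For $t\ge 0$ and a sample $X_1,\ldots,X_n$ put $$H_n^{(2)}(t)=\frac1{n^2}\sum_{i_1,i_2=1}^n \mathbf 1\{\max(X_{i_1},X_{i_2})<t\},$$ $$G_n^{(2)}(t)=\frac1{2n^2}\sum_{i_1,i_2=1}^n\left[\mathbf 1\{X_{i_1}+\tfrac{X_{i_2}}{2}<t\}+\mathbf 1\{\tfrac{X_{i_1}}{2}+X_{i_2}<t\}\right].$$ Let $F_n(t)=n^{-1}\sum_{i=1}^n\mathbf 1\{X_i<t\}$ be the empirical distribution function. The statistic is $$I_n^{(2)}=\int_0^\infty\left(H_n^{(2)}(t)-G_n^{(2)}(t)\right)dF_n(t)=\frac1n\sum_{l=1}^n\left(H_n^{(2)}(X_l)-G_n^{(2)}(X_l)\right).$$ $\mathcal N(0,\sigma^2)$ denotes the normal law with mean $0$ and variance $\sigma^2$, and $\xrightarrow{d}$ denotes convergence in distribution. *)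

theory Defs
  imports "HOL-Probability.Probability"
begin

text \<open>A sample of size \<open>n\<close> is given by the values \<open>x 0, \<dots>, x (n - 1)\<close> of a sequence \<open>x\<close>.\<close>

definition H2 :: "nat \<Rightarrow> (nat \<Rightarrow> real) \<Rightarrow> real \<Rightarrow> real" where
  "H2 n x t = 1 / (real n)\<^sup>2 * (\<Sum>i<n. \<Sum>j<n. of_bool (max (x i) (x j) < t))"

definition G2 :: "nat \<Rightarrow> (nat \<Rightarrow> real) \<Rightarrow> real \<Rightarrow> real" where
  "G2 n x t = 1 / (2 * (real n)\<^sup>2) *
     (\<Sum>i<n. \<Sum>j<n. of_bool (x i + x j / 2 < t) + of_bool (x i / 2 + x j < t))"

definition I2 :: "nat \<Rightarrow> (nat \<Rightarrow> real) \<Rightarrow> real" where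
  "I2 n x = 1 / real n * (\<Sum>l<n. H2 n x (x l) - G2 n x (x l))"

text \<open>
  \<open>I2\<close> is the integral of \<open>H2 - G2\<close> over \<open>[0, \<infinity>)\<close> with respect to the empirical distribution
  function \<open>F\<close>. As \<open>F\<close> is taken with a strict inequality it is left-continuous, so the associated
  measure is characterised by its values on the rays \<open>{..<t}\<close>; it is the uniform distribution on the
  sample.
\<close>

definition empirical_df :: "nat \<Rightarrow> (nat \<Rightarrow> real) \<Rightarrow> real \<Rightarrow> real" where
  "empirical_df n x t = 1 / real n * (\<Sum>i<n. of_bool (x i < t))"

definition empirical_pmf :: "nat \<Rightarrow> (nat \<Rightarrow> real) \<Rightarrow> real pmf" where
  "empirical_pmf n x = map_pmf x (pmf_of_set {..<n})"

lemma measure_empirical_pmf: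
  assumes "n > 0"
  shows "measure_pmf.prob (empirical_pmf n x) {..<t} = empirical_df n x t"
proof -
  have "{..<n} \<inter> x -` {..<t} = {i\<in>{..<n}. x i < t}"
    by auto
  then show ?thesis
    using assms by (auto simp: empirical_pmf_def empirical_df_def measure_pmf_of_set
        lessThan_empty_iff of_bool_def sum.If_cases Int_def vimage_def)
qed

lemma I2_eq_integral:
  assumes "n > 0" and "\<And>i. i < n \<Longrightarrow> x i \<ge> 0"
  shows "I2 n x = (LINT t:{0..}|measure_pmf (empirical_pmf n x). H2 n x t - G2 n x t)"
  using assms
  by (auto simp: I2_def empirical_pmf_def set_lebesgue_integral_def integral_pmf_of_set
      lessThan_empty_iff intro!: sum.cong)

end

theory Submission
  imports Defs "HOL-Real_Asymp.Real_Asymp"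
begin

text \<open>
  Put \<open>U i = exp (- l * X i)\<close>. These variables are independent and uniform on \<open>[0, 1]\<close>, and as
  \<open>x \<mapsto> exp (- l * x)\<close> is decreasing, the events \<open>max a b < c\<close> and \<open>a + b / 2 < c\<close> become
  \<open>w < min u v\<close> and \<open>w < u * sqrt v\<close> for the transformed values \<open>u, v, w\<close> of \<open>a, b, c\<close>. So the
  parameter \<open>l\<close> disappears and the statistic is a V-statistic of degree three, the average of the
  bounded kernel \<open>kern (w, u, v) = of_bool (w < min u v) - of_bool (w < u * sqrt v)\<close> over all
  triples of sample points (lemma \<open>I2_eq_V_statistic\<close>).

  For such statistics Hoeffding's projection method applies (\<open>V_statistic_weak_conv\<close>). Averaging the
  kernel over two of its arguments leaves three functions of one variable. Subtracting them (and
  correcting the constant) leaves a degenerate kernel \<open>k\<close>, which has mean zero once any one argument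
  is fixed. In the second moment of \<open>\<Sum> k (U i, U j, U m)\<close> over triples of distinct indices, the
  covariance of two summands therefore vanishes unless the triples share two indices; only
  \<open>O(n^4)\<close> pairs remain. Triples with a repeated index number only \<open>O(n^2)\<close>. The degenerate sum is
  thus of order \<open>n^2\<close> in mean (\<open>degenerate_sum_L1\<close>), and after scaling by \<open>n powr (- 5 / 2)\<close> it
  vanishes. What is left is a normalised sum of i.i.d. variables, to which the central limit theorem
  applies, and a perturbation that is small in mean does not change the limit
  (\<open>weak_conv_L1_perturbation\<close>).

  For the kernel above the projection on \<open>w\<close> is zero on \<open>[0, 1]\<close>, which expresses that \<open>max a b\<close> and
  \<open>a + b / 2\<close> have the same law for independent exponential variables. The projections on \<open>u\<close>
  and \<open>v\<close> add up to \<open>4 / 3 * u - u\<^sup>2 - sqrt u / 2\<close>, whose square has integral \<open>5 / 1512\<close>.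
\<close>

section \<open>Weak convergence under small perturbations and scaling\<close>

lemma cmod_iexp_diff_le: "cmod (iexp a - iexp b) \<le> \<bar>a - b\<bar>"
proof -
  have "iexp a - iexp b = iexp b * (iexp (a - b) - 1)"
    by (simp add: algebra_simps flip: exp_add)
  then show ?thesis
    using iexp_approx1[of "a - b" 0] by (simp add: norm_mult)
qed

context prob_space
begin

text \<open>
  As \<open>x \<mapsto> exp (\<i> * t * x)\<close> is Lipschitz with constant \<open>\<bar>t\<bar>\<close>, a perturbation that vanishes in mean moves
  the characteristic functions by an amount that tends to zero; Levy's theorem does the rest.
\<close>

lemma weak_conv_L1_perturbation:
  fixes S T :: "nat \<Rightarrow> 'a \<Rightarrow> real"
  assumes [measurable]: "\<And>n. S n \<in> borel_measurable M" "\<And>n. T n \<in> borel_measurable M"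
    and \<mu>: "real_distribution \<mu>"
    and conv: "weak_conv_m (\<lambda>n. distr M borel (S n)) \<mu>"
    and int: "\<And>n. integrable M (\<lambda>\<omega>. T n \<omega> - S n \<omega>)"
    and lim: "(\<lambda>n. expectation (\<lambda>\<omega>. \<bar>T n \<omega> - S n \<omega>\<bar>)) \<longlonglongrightarrow> 0"
  shows "weak_conv_m (\<lambda>n. distr M borel (T n)) \<mu>"
proof (rule levy_continuity)
  show rd: "real_distribution (distr M borel (T n))" for n
    by (rule real_distribution_distr) simp
  show "real_distribution \<mu>" by fact
  fix t
  have int_iexp: "integrable M (\<lambda>\<omega>. iexp (t * f \<omega>))" if [measurable]: "f \<in> borel_measurable M" for f
    by (rule integrable_const_bound[where B=1]) auto
  have char_eq: "char (distr M borel f) t = (CLINT \<omega>|M. iexp (t * f \<omega>))"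
    if "f \<in> borel_measurable M" for f
    using that by (simp add: char_def integral_distr)
  have "(\<lambda>n. char (distr M borel (S n)) t) \<longlonglongrightarrow> char \<mu> t"
    by (intro levy_continuity1 conv \<mu> real_distribution_distr) simp
  moreover have "(\<lambda>n. char (distr M borel (T n)) t - char (distr M borel (S n)) t) \<longlonglongrightarrow> 0"
  proof (rule Lim_null_comparison)
    have "cmod (char (distr M borel (T n)) t - char (distr M borel (S n)) t)
        \<le> \<bar>t\<bar> * expectation (\<lambda>\<omega>. \<bar>T n \<omega> - S n \<omega>\<bar>)" for n
    proof -
      have "char (distr M borel (T n)) t - char (distr M borel (S n)) t
          = (CLINT \<omega>|M. iexp (t * T n \<omega>) - iexp (t * S n \<omega>))"
        by (simp only: char_eq assms(1,2) Bochner_Integration.integral_diff int_iexp)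
      also have "cmod \<dots> \<le> expectation (\<lambda>\<omega>. cmod (iexp (t * T n \<omega>) - iexp (t * S n \<omega>)))"
        by (rule integral_norm_bound)
      also have "\<dots> \<le> expectation (\<lambda>\<omega>. \<bar>t\<bar> * \<bar>T n \<omega> - S n \<omega>\<bar>)"
      proof (rule integral_mono)
        show "cmod (iexp (t * T n \<omega>) - iexp (t * S n \<omega>)) \<le> \<bar>t\<bar> * \<bar>T n \<omega> - S n \<omega>\<bar>" for \<omega>
          using cmod_iexp_diff_le[of "t * T n \<omega>" "t * S n \<omega>"]
          by (simp add: abs_mult flip: right_diff_distrib)
      qed (intro integrable_norm integrable_abs integrable_mult_right Bochner_Integration.integrable_diff int int_iexp; simp)+
      finally show ?thesis by simp
    qed
    then show "\<forall>\<^sub>F n in sequentially. cmod (char (distr M borel (T n)) t - char (distr M borel (S n)) t)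
        \<le> \<bar>t\<bar> * expectation (\<lambda>\<omega>. \<bar>T n \<omega> - S n \<omega>\<bar>)" by simp
    show "(\<lambda>n. \<bar>t\<bar> * expectation (\<lambda>\<omega>. \<bar>T n \<omega> - S n \<omega>\<bar>)) \<longlonglongrightarrow> 0"
      using tendsto_mult_left[OF lim, of "\<bar>t\<bar>"] by simp
  qed
  ultimately show "(\<lambda>n. char (distr M borel (T n)) t) \<longlonglongrightarrow> char \<mu> t"
    using tendsto_add by fastforce
qed

lemma weak_conv_scale:
  fixes S :: "nat \<Rightarrow> 'a \<Rightarrow> real"
  assumes [measurable]: "\<And>n. S n \<in> borel_measurable M"
    and \<mu>: "real_distribution \<mu>"
    and conv: "weak_conv_m (\<lambda>n. distr M borel (S n)) \<mu>"
  shows "weak_conv_m (\<lambda>n. distr M borel (\<lambda>\<omega>. c * S n \<omega>)) (distr \<mu> borel (\<lambda>x. c * x))"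
proof (rule levy_continuity)
  interpret \<mu>: real_distribution \<mu> by fact
  show "real_distribution (distr M borel (\<lambda>\<omega>. c * S n \<omega>))" for n
    by (rule real_distribution_distr) simp
  show "real_distribution (distr \<mu> borel (\<lambda>x. c * x))"
    by (rule \<mu>.real_distribution_distr) simp
  fix t
  have "(\<lambda>n. char (distr M borel (S n)) (t * c)) \<longlonglongrightarrow> char \<mu> (t * c)"
    by (intro levy_continuity1 conv \<mu> real_distribution_distr) simp
  then show "(\<lambda>n. char (distr M borel (\<lambda>\<omega>. c * S n \<omega>)) t) \<longlonglongrightarrow> char (distr \<mu> borel (\<lambda>x. c * x)) t"
    by (simp add: char_def integral_distr mult_ac)
qed

lemma abs_expectation_le:
  assumes [measurable]: "f \<in> borel_measurable M" and "\<And>x. \<bar>f x\<bar> \<le> (B :: real)"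
  shows "\<bar>expectation f\<bar> \<le> B"
proof -
  have "integrable M f" by (rule integrable_const_bound[where B=B]) (use assms in auto)
  then have "expectation (\<lambda>x. \<bar>f x\<bar>) \<le> expectation (\<lambda>_. B)"
    by (intro integral_mono) (use assms in auto)
  then have "expectation (\<lambda>x. \<bar>f x\<bar>) \<le> B" by (simp add: prob_space)
  with integral_norm_bound[of M f] show ?thesis unfolding real_norm_def by (rule order_trans)
qed

end

lemma distr_std_normal_scale:
  assumes "\<sigma> > 0"
  shows "distr std_normal_distribution borel (\<lambda>x. \<sigma> * x) = density lborel (normal_density 0 \<sigma>)"
proof -
  interpret prob_space std_normal_distribution
    by (rule prob_space_normal_density) simp
  have "distributed std_normal_distribution lborel (\<lambda>x. x) std_normal_density"
    by (simp add: distributed_def distr_id2)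
  from normal_density_affine[OF this, of \<sigma> 0] assms
  have "distributed std_normal_distribution lborel (\<lambda>x. \<sigma> * x) (normal_density 0 \<sigma>)" by simp
  then show ?thesis
    unfolding distributed_def by (metis distr_cong sets_lborel)
qed

section \<open>Degenerate kernels on an i.i.d. sample\<close>

locale iid_sample = prob_space M for M :: "'a measure" +
  fixes X :: "nat \<Rightarrow> 'a \<Rightarrow> real" and D :: "real measure"
  assumes indep: "indep_vars (\<lambda>_. borel) X UNIV"
    and distr_X: "\<And>i. distr M borel (X i) = D"
begin

lemma X_measurable [measurable]: "X i \<in> borel_measurable M"
  using indep unfolding indep_vars_def2 by simp

lemma sets_D [measurable_cong, simp]: "sets D = sets borel"
  using distr_X[of 0] by (metis sets_distr)

lemma space_D [simp]: "space D = UNIV"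
  using sets_eq_imp_space_eq[OF sets_D] by simp

sublocale D: prob_space D
  using prob_space_distr[OF X_measurable, of 0] distr_X[of 0] by simp

sublocale DD: pair_prob_space D D ..

lemma distr_pair:
  assumes "a \<noteq> b"
  shows "distr M (borel \<Otimes>\<^sub>M borel) (\<lambda>\<omega>. (X a \<omega>, X b \<omega>)) = D \<Otimes>\<^sub>M D"
proof -
  have "indep_var borel ((\<lambda>v. v a) \<circ> (\<lambda>\<omega>. \<lambda>i\<in>{a}. X i \<omega>)) borel ((\<lambda>v. v b) \<circ> (\<lambda>\<omega>. \<lambda>i\<in>{b}. X i \<omega>))"
    by (intro indep_var_compose[OF indep_var_restrict[OF indep]]) (use assms in auto)
  then have "indep_var borel (X a) borel (X b)" by (simp add: comp_def)
  then show ?thesis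
    by (simp add: indep_var_distribution_eq distr_X)
qed

text \<open>
  The two indices \<open>a\<close>, \<open>b\<close> occur nowhere else in the product, so they can be integrated out first
  while all other sample values are held fixed; by degeneracy this gives zero already. The
  independence of the two groups is expressed through restrictions of the whole sequence to \<open>A\<close> and
  \<open>J\<close>, because \<open>indep_var\<close> requires both variables to have the same type.
\<close>

lemma expectation_degenerate_product:
  fixes k :: "real \<times> real \<times> real \<Rightarrow> real" and \<Phi> :: "real \<times> real \<times> real \<Rightarrow> real"
  assumes k [measurable]: "k \<in> borel_measurable (borel \<Otimes>\<^sub>M borel \<Otimes>\<^sub>M borel)"
    and \<Phi> [measurable]: "\<Phi> \<in> borel_measurable (borel \<Otimes>\<^sub>M borel \<Otimes>\<^sub>M borel)"
    and k_bound: "\<And>x. \<bar>k x\<bar> \<le> K" and \<Phi>_bound: "\<And>x. \<bar>\<Phi> x\<bar> \<le> L"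
    and deg: "\<And>x. (\<integral>y. k (x, y) \<partial>(D \<Otimes>\<^sub>M D)) = 0"
    and ab: "a \<noteq> b" "{a, b} \<inter> {p, q, r, c} = {}"
  shows "expectation (\<lambda>\<omega>. \<Phi> (X p \<omega>, X q \<omega>, X r \<omega>) * k (X c \<omega>, X a \<omega>, X b \<omega>)) = 0"
proof -
  define A J where "A = {a, b}" and "J = {p, q, r, c}"
  define N where "N = (\<lambda>I :: nat set. PiM I (\<lambda>_. borel :: real measure))"
  define V where "V = (\<lambda>I \<omega>. \<lambda>i\<in>I. X i \<omega>)"
  have V [measurable]: "V I \<in> measurable M (N I)" for I
    unfolding V_def N_def by measurable
  have ind: "indep_var (N J) (V J) (N A) (V A)"
    unfolding V_def N_def by (rule indep_var_restrict[OF indep]) (use ab in \<open>auto simp: A_def J_def\<close>)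
  interpret J: prob_space "distr M (N J) (V J)" by (rule prob_space_distr) simp
  interpret A: prob_space "distr M (N A) (V A)" by (rule prob_space_distr) simp
  interpret JA: pair_prob_space "distr M (N J) (V J)" "distr M (N A) (V A)" ..
  have comp [measurable]: "(\<lambda>v. v i) \<in> borel_measurable (N I)" if "i \<in> I" for i I
    unfolding N_def using that by measurable
  have mem: "p \<in> J" "q \<in> J" "r \<in> J" "c \<in> J" "a \<in> A" "b \<in> A"
    by (auto simp: A_def J_def)
  note [measurable] = mem[THEN comp]
  define f where "f = (\<lambda>(v, w). \<Phi> (v p, v q, v r) * k (v c, w a, w b))"
  have f [measurable]: "f \<in> borel_measurable (N J \<Otimes>\<^sub>M N A)"
    unfolding f_def by measurable
  have f_bound: "\<bar>f x\<bar> \<le> L * K" for x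
    unfolding f_def using k_bound \<Phi>_bound
    by (auto simp: abs_mult split: prod.split intro!: mult_mono order_trans[OF abs_ge_zero])
  have int: "integrable (distr M (N J) (V J) \<Otimes>\<^sub>M distr M (N A) (V A)) f"
    by (rule JA.P.integrable_const_bound[where B="L * K"]) (use f_bound in auto)
  have inner: "(\<integral>w. k (x, w a, w b) \<partial>distr M (N A) (V A)) = 0" for x
  proof -
    have "(\<integral>w. k (x, w a, w b) \<partial>distr M (N A) (V A)) = expectation (\<lambda>\<omega>. k (x, X a \<omega>, X b \<omega>))"
      by (subst integral_distr[OF V]) (auto simp: V_def A_def)
    also have "\<dots> = (\<integral>y. k (x, y) \<partial>distr M (borel \<Otimes>\<^sub>M borel) (\<lambda>\<omega>. (X a \<omega>, X b \<omega>)))"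
      by (subst integral_distr) auto
    also have "\<dots> = 0"
      using deg[of x] by (simp add: distr_pair[OF ab(1)])
    finally show ?thesis .
  qed
  have "expectation (\<lambda>\<omega>. \<Phi> (X p \<omega>, X q \<omega>, X r \<omega>) * k (X c \<omega>, X a \<omega>, X b \<omega>))
      = expectation (\<lambda>\<omega>. f (V J \<omega>, V A \<omega>))"
    by (simp add: f_def V_def A_def J_def)
  also have "\<dots> = (\<integral>x. f x \<partial>distr M (N J \<Otimes>\<^sub>M N A) (\<lambda>\<omega>. (V J \<omega>, V A \<omega>)))"
    by (subst integral_distr) auto
  also have "\<dots> = (\<integral>x. f x \<partial>(distr M (N J) (V J) \<Otimes>\<^sub>M distr M (N A) (V A)))"
    using ind by (simp add: indep_var_distribution_eq)
  also have "\<dots> = (\<integral>v. (\<integral>w. f (v, w) \<partial>distr M (N A) (V A)) \<partial>distr M (N J) (V J))"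
    by (rule JA.integral_fst'[OF int, symmetric])
  also have "\<dots> = 0"
    by (simp add: f_def inner)
  finally show ?thesis .
qed


text \<open>
  If two of the indices of \<open>t\<close> do not occur in \<open>s\<close>, the covariance of the summands for \<open>s\<close> and \<open>t\<close> is
  zero. Otherwise two entries of \<open>t\<close> lie among the at most three indices of \<open>s\<close>, which happens for
  at most \<open>3 * 9 * n\<close> triples \<open>t\<close>; there are at most \<open>n ^ 3\<close> choices of \<open>s\<close>.
\<close>

lemma degenerate_sum_second_moment:
  fixes k :: "real \<times> real \<times> real \<Rightarrow> real" and n :: nat
  defines "T \<equiv> {(i, j, m) \<in> {..<n} \<times> {..<n} \<times> {..<n}. i \<noteq> j \<and> j \<noteq> m \<and> i \<noteq> m}"
  assumes k [measurable]: "k \<in> borel_measurable (borel \<Otimes>\<^sub>M borel \<Otimes>\<^sub>M borel)"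
    and k_bound: "\<And>x. \<bar>k x\<bar> \<le> K"
    and deg: "\<And>x. (\<integral>(y, z). k (x, y, z) \<partial>(D \<Otimes>\<^sub>M D)) = 0"
      "\<And>y. (\<integral>(x, z). k (x, y, z) \<partial>(D \<Otimes>\<^sub>M D)) = 0"
      "\<And>z. (\<integral>(x, y). k (x, y, z) \<partial>(D \<Otimes>\<^sub>M D)) = 0"
  shows "expectation (\<lambda>\<omega>. (\<Sum>(i, j, m)\<in>T. k (X i \<omega>, X j \<omega>, X m \<omega>))\<^sup>2) \<le> 27 * K\<^sup>2 * real n ^ 4"
proof -
  define Y where "Y = (\<lambda>(i, j, m) \<omega>. k (X i \<omega>, X j \<omega>, X m \<omega>))"
  have Y [measurable]: "Y t \<in> borel_measurable M" for t
    unfolding Y_def by (cases t) simp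
  have Y_bound: "\<bar>Y t \<omega>\<bar> \<le> K" for t \<omega>
    unfolding Y_def by (cases t) (simp add: k_bound)
  have K: "0 \<le> K" using k_bound[of undefined] by linarith
  have YY_bound: "\<bar>Y s \<omega> * Y t \<omega>\<bar> \<le> K\<^sup>2" for s t \<omega>
    unfolding abs_mult power2_eq_square by (intro mult_mono Y_bound) (use K in auto)
  have int: "integrable M (\<lambda>\<omega>. Y s \<omega> * Y t \<omega>)" for s t
    by (rule integrable_const_bound[where B="K\<^sup>2"]) (use YY_bound in auto)
  (* C s consists of the triples with two entries in S s; it covers all summands t that can correlate
     with s. *)
  define S where "S = (\<lambda>(i :: nat, j :: nat, m :: nat). {i, j, m})"
  define C where "C = (\<lambda>s. S s \<times> S s \<times> {..<n} \<union> S s \<times> {..<n} \<times> S s \<union> {..<n} \<times> S s \<times> S s)"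
  have card_S: "card (S s) \<le> 3" "finite (S s)" for s
    unfolding S_def by (cases s; simp add: card_insert_if)+
  have finC: "finite (C s)" for s
    unfolding C_def using card_S by auto
  have card_C: "card (C s) \<le> 27 * n" for s
  proof -
    have *: "card (S s) * card (S s) \<le> 3 * 3"
      by (intro mult_mono card_S) auto
    have "card (C s) \<le> card (S s \<times> S s \<times> {..<n}) + card (S s \<times> {..<n} \<times> S s) + card ({..<n} \<times> S s \<times> S s)"
      unfolding C_def by (meson card_Un_le add_le_mono order_refl order_trans)
    also have "\<dots> = 3 * (card (S s) * card (S s) * n)"
      by (simp add: card_cartesian_product)
    also have "\<dots> \<le> 3 * (3 * 3 * n)"
      using mult_le_mono1[OF *, of n] by simp
    finally show ?thesis by simp
  qed
  have zero: "expectation (\<lambda>\<omega>. Y s \<omega> * Y t \<omega>) = 0" if t: "t \<in> T" "t \<notin> C s" for s t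
  proof -
    obtain p q r where s: "s = (p, q, r)" by (cases s)
    obtain i j m where t': "t = (i, j, m)" by (cases t)
    have ijm: "i \<noteq> j" "j \<noteq> m" "i \<noteq> m" "i < n" "j < n" "m < n"
      using t by (auto simp: T_def t')
    have Ydef: "Y s = (\<lambda>\<omega>. k (X p \<omega>, X q \<omega>, X r \<omega>))" "Y t = (\<lambda>\<omega>. k (X i \<omega>, X j \<omega>, X m \<omega>))"
      by (auto simp: Y_def s t')
    consider "j \<notin> S s" "m \<notin> S s" | "i \<notin> S s" "m \<notin> S s" | "i \<notin> S s" "j \<notin> S s"
      using t(2) ijm by (auto simp: C_def t')
    then show ?thesis
    proof cases
      case 1
      show ?thesis unfolding Ydef
        by (rule expectation_degenerate_product[where K=K and L=K])
          (use 1 ijm deg(1) in \<open>auto simp: k_bound S_def s case_prod_unfold\<close>)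
    next
      case 2
      have "expectation (\<lambda>\<omega>. k (X p \<omega>, X q \<omega>, X r \<omega>) * (\<lambda>(y, x, z). k (x, y, z)) (X j \<omega>, X i \<omega>, X m \<omega>)) = 0"
        by (rule expectation_degenerate_product[where K=K and L=K])
          (use 2 ijm deg(2) in \<open>auto simp: k_bound S_def s case_prod_unfold\<close>)
      then show ?thesis unfolding Ydef by simp
    next
      case 3
      have "expectation (\<lambda>\<omega>. k (X p \<omega>, X q \<omega>, X r \<omega>) * (\<lambda>(z, x, y). k (x, y, z)) (X m \<omega>, X i \<omega>, X j \<omega>)) = 0"
        by (rule expectation_degenerate_product[where K=K and L=K])
          (use 3 ijm deg(3) in \<open>auto simp: k_bound S_def s case_prod_unfold\<close>)
      then show ?thesis unfolding Ydef by simp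
    qed
  qed
  have T_sub: "T \<subseteq> {..<n} \<times> {..<n} \<times> {..<n}" by (auto simp: T_def)
  have finT: "finite T" by (rule finite_subset[OF T_sub]) simp
  have cardT: "card T \<le> n ^ 3"
    using card_mono[OF _ T_sub] by (simp add: card_cartesian_product power3_eq_cube)
  have row: "(\<Sum>t\<in>T. expectation (\<lambda>\<omega>. Y s \<omega> * Y t \<omega>)) \<le> 27 * K\<^sup>2 * real n" for s
  proof -
    have "(\<Sum>t\<in>T. expectation (\<lambda>\<omega>. Y s \<omega> * Y t \<omega>)) = (\<Sum>t\<in>T \<inter> C s. expectation (\<lambda>\<omega>. Y s \<omega> * Y t \<omega>))"
      by (rule sum.mono_neutral_right) (use finT zero in auto)
    also have "\<dots> \<le> (\<Sum>t\<in>T \<inter> C s. K\<^sup>2)"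
    proof (rule sum_mono)
      fix t
      have "expectation (\<lambda>\<omega>. Y s \<omega> * Y t \<omega>) \<le> expectation (\<lambda>_. K\<^sup>2)"
        by (rule integral_mono[OF int _ abs_le_D1[OF YY_bound]]) simp
      then show "expectation (\<lambda>\<omega>. Y s \<omega> * Y t \<omega>) \<le> K\<^sup>2" by (simp add: prob_space)
    qed
    also have "\<dots> = K\<^sup>2 * real (card (T \<inter> C s))" by simp
    also have "\<dots> \<le> K\<^sup>2 * real (27 * n)"
      using card_mono[OF finC, of "T \<inter> C s" s] card_C[of s]
      by (intro mult_left_mono of_nat_mono) auto
    finally show ?thesis by (simp add: mult_ac)
  qed
  have "expectation (\<lambda>\<omega>. (\<Sum>t\<in>T. Y t \<omega>)\<^sup>2) = expectation (\<lambda>\<omega>. \<Sum>s\<in>T. \<Sum>t\<in>T. Y s \<omega> * Y t \<omega>)"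
    by (simp add: power2_eq_square sum_product)
  also have "\<dots> = (\<Sum>s\<in>T. \<Sum>t\<in>T. expectation (\<lambda>\<omega>. Y s \<omega> * Y t \<omega>))"
    by (simp add: int)
  also have "\<dots> \<le> (\<Sum>s\<in>T. 27 * K\<^sup>2 * real n)"
    by (rule sum_mono) (rule row)
  also have "\<dots> = real (card T) * (27 * K\<^sup>2 * real n)" by simp
  also have "\<dots> \<le> real (n ^ 3) * (27 * K\<^sup>2 * real n)"
    using cardT by (intro mult_right_mono) auto
  also have "\<dots> = 27 * K\<^sup>2 * real n ^ 4" by (simp add: eval_nat_numeral)
  finally show ?thesis by (simp add: Y_def case_prod_unfold)
qed

text \<open>
  Triples with a repeated index are bounded trivially and contribute the \<open>3\<close> of the constant; the
  triples of distinct indices contribute \<open>sqrt 27 \<le> 6\<close>.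
\<close>

lemma degenerate_sum_L1:
  fixes k :: "real \<times> real \<times> real \<Rightarrow> real"
  assumes k [measurable]: "k \<in> borel_measurable (borel \<Otimes>\<^sub>M borel \<Otimes>\<^sub>M borel)"
    and k_bound: "\<And>x. \<bar>k x\<bar> \<le> K"
    and deg: "\<And>x. (\<integral>(y, z). k (x, y, z) \<partial>(D \<Otimes>\<^sub>M D)) = 0"
      "\<And>y. (\<integral>(x, z). k (x, y, z) \<partial>(D \<Otimes>\<^sub>M D)) = 0"
      "\<And>z. (\<integral>(x, y). k (x, y, z) \<partial>(D \<Otimes>\<^sub>M D)) = 0"
  shows "expectation (\<lambda>\<omega>. \<bar>\<Sum>i<n. \<Sum>j<n. \<Sum>m<n. k (X i \<omega>, X j \<omega>, X m \<omega>)\<bar>) \<le> 9 * K * (real n)\<^sup>2"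
proof -
  define B where "B = {..<n} \<times> {..<n} \<times> {..<n}"
  define T where "T = {(i, j, m) \<in> {..<n} \<times> {..<n} \<times> {..<n}. i \<noteq> j \<and> j \<noteq> m \<and> i \<noteq> m}"
  define Y where "Y = (\<lambda>(i, j, m) \<omega>. k (X i \<omega>, X j \<omega>, X m \<omega>))"
  have Y [measurable]: "Y t \<in> borel_measurable M" for t
    unfolding Y_def by (cases t) simp
  have Y_bound: "\<bar>Y t \<omega>\<bar> \<le> K" for t \<omega>
    unfolding Y_def by (cases t) (simp add: k_bound)
  have K: "0 \<le> K" using k_bound[of undefined] by linarith
  have finB: "finite B" by (simp add: B_def)
  have T_sub: "T \<subseteq> B" by (auto simp: T_def B_def)
  have finT: "finite T" using finite_subset[OF T_sub finB] .
  have sum_bound: "\<bar>\<Sum>t\<in>A. Y t \<omega>\<bar> \<le> real (card A) * K" for A \<omega>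
    using order_trans[OF sum_abs sum_bounded_above[of A "\<lambda>t. \<bar>Y t \<omega>\<bar>" K]] Y_bound by simp
  have card_diff: "card (B - T) \<le> 3 * n\<^sup>2"
  proof -
    define E where "E = {..<n} \<times> {..<n}"
    have "B - T \<subseteq> (\<lambda>(i, j). (i, i, j)) ` E \<union> (\<lambda>(i, j). (i, j, j)) ` E \<union> (\<lambda>(i, j). (i, j, i)) ` E"
      by (auto simp: B_def T_def E_def image_iff)
    then have "card (B - T) \<le> card ((\<lambda>(i, j). (i, i, j)) ` E \<union> (\<lambda>(i, j). (i, j, j)) ` E \<union> (\<lambda>(i, j). (i, j, i)) ` E)"
      by (intro card_mono) (auto simp: E_def)
    also have "\<dots> \<le> card E + card E + card E"
      by (intro order_trans[OF card_Un_le] add_mono card_image_le) (simp_all add: E_def)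
    also have "\<dots> = 3 * n\<^sup>2" by (simp add: E_def card_cartesian_product power2_eq_square)
    finally show ?thesis .
  qed
  let ?S = "\<lambda>\<omega>. \<Sum>t\<in>T. Y t \<omega>"
  have S_int: "integrable M ?S"
    by (rule integrable_const_bound[where B="real (card T) * K"]) (use sum_bound in auto)
  have S2_int: "integrable M (\<lambda>\<omega>. (?S \<omega>)\<^sup>2)"
    by (rule integrable_const_bound[where B="(real (card T) * K)\<^sup>2"])
      (use sum_bound in \<open>auto intro!: power2_le_iff_abs_le[THEN iffD2] simp: K\<close>)
  have "(expectation (\<lambda>\<omega>. \<bar>?S \<omega>\<bar>))\<^sup>2 \<le> expectation (\<lambda>\<omega>. \<bar>?S \<omega>\<bar>\<^sup>2)"
    using variance_eq[of "\<lambda>\<omega>. \<bar>?S \<omega>\<bar>"] variance_positive[of "\<lambda>\<omega>. \<bar>?S \<omega>\<bar>"] S_int S2_int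
    by simp
  also have "\<dots> \<le> 27 * K\<^sup>2 * real n ^ 4"
    using degenerate_sum_second_moment[OF k k_bound deg, of n] by (simp add: Y_def T_def case_prod_unfold)
  also have "\<dots> \<le> (6 * K * (real n)\<^sup>2)\<^sup>2"
    by (simp add: power_mult_distrib mult_right_mono)
  finally have S_L1: "expectation (\<lambda>\<omega>. \<bar>?S \<omega>\<bar>) \<le> 6 * K * (real n)\<^sup>2"
    using K by (auto intro: power2_le_imp_le)
  have "expectation (\<lambda>\<omega>. \<bar>\<Sum>t\<in>B. Y t \<omega>\<bar>) \<le> expectation (\<lambda>\<omega>. 3 * K * (real n)\<^sup>2 + \<bar>?S \<omega>\<bar>)"
  proof (rule integral_mono)
    show "integrable M (\<lambda>\<omega>. \<bar>\<Sum>t\<in>B. Y t \<omega>\<bar>)"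
      by (rule integrable_const_bound[where B="real (card B) * K"]) (use sum_bound in auto)
    show "integrable M (\<lambda>\<omega>. 3 * K * (real n)\<^sup>2 + \<bar>?S \<omega>\<bar>)" using S_int by auto
    fix \<omega>
    have "\<bar>\<Sum>t\<in>B. Y t \<omega>\<bar> \<le> \<bar>\<Sum>t\<in>B - T. Y t \<omega>\<bar> + \<bar>?S \<omega>\<bar>"
      by (subst sum.subset_diff[OF T_sub finB]) (rule abs_triangle_ineq)
    moreover have "real (card (B - T)) \<le> 3 * (real n)\<^sup>2"
      using of_nat_mono[OF card_diff, where 'a=real] by simp
    then have "\<bar>\<Sum>t\<in>B - T. Y t \<omega>\<bar> \<le> 3 * (real n)\<^sup>2 * K"
      using order_trans[OF sum_bound mult_right_mono[OF _ K]] by blast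
    ultimately show "\<bar>\<Sum>t\<in>B. Y t \<omega>\<bar> \<le> 3 * K * (real n)\<^sup>2 + \<bar>?S \<omega>\<bar>"
      by (simp add: mult_ac)
  qed
  also have "\<dots> = 3 * K * (real n)\<^sup>2 + expectation (\<lambda>\<omega>. \<bar>?S \<omega>\<bar>)"
    using S_int by (simp add: prob_space)
  also have "\<dots> \<le> 9 * K * (real n)\<^sup>2" using S_L1 by linarith
  finally show ?thesis
    by (simp add: B_def Y_def sum.cartesian_product case_prod_unfold)
qed

end

section \<open>The central limit theorem for V-statistics of degree three\<close>

context iid_sample
begin

lemma distr_compose_X:
  assumes [measurable]: "f \<in> borel_measurable borel"
  shows "distr M borel (\<lambda>\<omega>. f (X i \<omega>)) = distr D borel f"
  by (subst distr_X[of i, symmetric], subst distr_distr) (auto simp: comp_def)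

lemma expectation_X:
  fixes f :: "real \<Rightarrow> real"
  assumes [measurable]: "f \<in> borel_measurable borel"
  shows "expectation (\<lambda>\<omega>. f (X i \<omega>)) = (\<integral>x. f x \<partial>D)"
  by (subst distr_X[of i, symmetric], subst integral_distr) auto

lemma normalised_sum_weak_conv:
  assumes [measurable]: "\<psi> \<in> borel_measurable borel"
    and bound: "\<And>x. \<bar>\<psi> x\<bar> \<le> L"
    and mean: "(\<integral>x. \<psi> x \<partial>D) = 0"
    and var: "(\<integral>x. (\<psi> x)\<^sup>2 \<partial>D) = \<sigma>\<^sup>2"
    and \<sigma>: "\<sigma> > 0"
  shows "weak_conv_m (\<lambda>n. distr M borel (\<lambda>\<omega>. (\<Sum>i<n. \<psi> (X i \<omega>)) / sqrt (real n)))
    (density lborel (normal_density 0 \<sigma>))"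
proof -
  have L: "0 \<le> L" using bound[of 0] by linarith
  have "weak_conv_m (\<lambda>n. distr M borel (\<lambda>\<omega>. (\<Sum>i<n. \<psi> (X i \<omega>)) / sqrt (n * \<sigma>\<^sup>2))) std_normal_distribution"
  proof (rule central_limit_theorem_zero_mean)
    show "indep_vars (\<lambda>i. borel) (\<lambda>i \<omega>. \<psi> (X i \<omega>)) UNIV"
      by (rule indep_vars_compose2[OF indep]) simp
    show mean': "expectation (\<lambda>\<omega>. \<psi> (X i \<omega>)) = 0" for i
      by (simp add: expectation_X mean)
    show "integrable M (\<lambda>\<omega>. (\<psi> (X i \<omega>))\<^sup>2)" for i
      by (rule integrable_const_bound[where B="L\<^sup>2"])
        (use bound in \<open>auto intro!: power2_le_iff_abs_le[THEN iffD2] simp: L\<close>)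
    show "variance (\<lambda>\<omega>. \<psi> (X i \<omega>)) = \<sigma>\<^sup>2" for i
      using expectation_X[of "\<lambda>x. (\<psi> x)\<^sup>2" i] by (simp add: mean' var)
    show "distr M borel (\<lambda>\<omega>. \<psi> (X i \<omega>)) = distr D borel \<psi>" for i
      by (simp add: distr_compose_X)
  qed fact
  from weak_conv_scale[OF _ real_dist_normal_dist this, of \<sigma>] show ?thesis
    using \<sigma> by (simp add: distr_std_normal_scale real_sqrt_mult)
qed

lemma product_integrals:
  fixes f :: "real \<times> real \<Rightarrow> real"
  assumes [measurable]: "f \<in> borel_measurable (borel \<Otimes>\<^sub>M borel)" and bound: "\<And>x. \<bar>f x\<bar> \<le> B"
  shows "integrable (D \<Otimes>\<^sub>M D) f"
    and "(\<integral>x. f x \<partial>(D \<Otimes>\<^sub>M D)) = (\<integral>x. \<integral>y. f (x, y) \<partial>D \<partial>D)"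
    and "(\<integral>x. f x \<partial>(D \<Otimes>\<^sub>M D)) = (\<integral>y. \<integral>x. f (x, y) \<partial>D \<partial>D)"
proof -
  show *: "integrable (D \<Otimes>\<^sub>M D) f"
    by (rule DD.P.integrable_const_bound[where B=B]) (use bound in auto)
  show "(\<integral>x. f x \<partial>(D \<Otimes>\<^sub>M D)) = (\<integral>x. \<integral>y. f (x, y) \<partial>D \<partial>D)"
    by (rule DD.integral_fst'[OF *, symmetric])
  show "(\<integral>x. f x \<partial>(D \<Otimes>\<^sub>M D)) = (\<integral>y. \<integral>x. f (x, y) \<partial>D \<partial>D)"
    using * by (subst DD.integral_snd) (auto simp: case_prod_unfold)
qed

text \<open>
  The Hoeffding projections of a kernel: the conditional expectation of \<open>g (x, y, z)\<close> for
  independent arguments with law \<open>D\<close>, given one of them.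
\<close>

definition proj1 :: "(real \<times> real \<times> real \<Rightarrow> real) \<Rightarrow> real \<Rightarrow> real" where
  "proj1 g x = (\<integral>(y, z). g (x, y, z) \<partial>(D \<Otimes>\<^sub>M D))"

definition proj2 :: "(real \<times> real \<times> real \<Rightarrow> real) \<Rightarrow> real \<Rightarrow> real" where
  "proj2 g y = (\<integral>(x, z). g (x, y, z) \<partial>(D \<Otimes>\<^sub>M D))"

definition proj3 :: "(real \<times> real \<times> real \<Rightarrow> real) \<Rightarrow> real \<Rightarrow> real" where
  "proj3 g z = (\<integral>(x, y). g (x, y, z) \<partial>(D \<Otimes>\<^sub>M D))"

lemma proj_measurable [measurable]:
  assumes [measurable]: "g \<in> borel_measurable (borel \<Otimes>\<^sub>M borel \<Otimes>\<^sub>M borel)"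
  shows "proj1 g \<in> borel_measurable borel" "proj2 g \<in> borel_measurable borel"
    "proj3 g \<in> borel_measurable borel"
  unfolding proj1_def proj2_def proj3_def by measurable

lemma abs_proj_le:
  assumes [measurable]: "g \<in> borel_measurable (borel \<Otimes>\<^sub>M borel \<Otimes>\<^sub>M borel)"
    and bound: "\<And>x. \<bar>g x\<bar> \<le> B"
  shows "\<bar>proj1 g x\<bar> \<le> B" "\<bar>proj2 g x\<bar> \<le> B" "\<bar>proj3 g x\<bar> \<le> B"
  unfolding proj1_def proj2_def proj3_def
  by (rule DD.P.abs_expectation_le; use bound in \<open>auto split: prod.split\<close>)+

text \<open>
  All three are the mean of the kernel, by Fubini. Each of the two comparisons goes through the
  function of two variables \<open>h\<close> or \<open>h'\<close> that remains when only the common third argument has been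
  integrated out.
\<close>

lemma integral_proj_eq:
  assumes g [measurable]: "g \<in> borel_measurable (borel \<Otimes>\<^sub>M borel \<Otimes>\<^sub>M borel)"
    and bound: "\<And>x. \<bar>g x\<bar> \<le> B"
  shows "(\<integral>y. proj2 g y \<partial>D) = (\<integral>x. proj1 g x \<partial>D)" "(\<integral>z. proj3 g z \<partial>D) = (\<integral>x. proj1 g x \<partial>D)"
proof -
  define h where "h = (\<lambda>(x, y). \<integral>z. g (x, y, z) \<partial>D)"
  have [measurable]: "h \<in> borel_measurable (borel \<Otimes>\<^sub>M borel)"
    unfolding h_def by measurable
  have h_bound: "\<bar>h x\<bar> \<le> B" for x
    unfolding h_def by (cases x) (auto intro!: D.abs_expectation_le bound)
  define h' where "h' = (\<lambda>(x, z). \<integral>y. g (x, y, z) \<partial>D)"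
  have [measurable]: "h' \<in> borel_measurable (borel \<Otimes>\<^sub>M borel)"
    unfolding h'_def by measurable
  have h'_bound: "\<bar>h' x\<bar> \<le> B" for x
    unfolding h'_def by (cases x) (auto intro!: D.abs_expectation_le bound)
  have p: "proj1 g x = (\<integral>y. h (x, y) \<partial>D)" "proj1 g x = (\<integral>z. h' (x, z) \<partial>D)"
    "proj2 g x = (\<integral>x'. h (x', x) \<partial>D)" "proj3 g x = (\<integral>x'. h' (x', x) \<partial>D)" for x
    unfolding proj1_def proj2_def proj3_def h_def h'_def
    by (subst product_integrals(2,3)[where B=B], use bound in \<open>auto split: prod.split\<close>)+
  show "(\<integral>y. proj2 g y \<partial>D) = (\<integral>x. proj1 g x \<partial>D)"
    unfolding p(1,3) using product_integrals(2,3)[of h, OF _ h_bound] by simp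
  show "(\<integral>z. proj3 g z \<partial>D) = (\<integral>x. proj1 g x \<partial>D)"
    unfolding p(2,4) using product_integrals(2,3)[of h', OF _ h'_bound] by simp
qed

text \<open>
  The central limit theorem for V-statistics of degree three with bounded kernel. The degenerate part
  has mean absolute value of order \<open>n\<^sup>2\<close>, hence contributes \<open>O(1 / sqrt n)\<close> to the normalised statistic.
\<close>

theorem V_statistic_weak_conv:
  fixes g :: "real \<times> real \<times> real \<Rightarrow> real"
  assumes g [measurable]: "g \<in> borel_measurable (borel \<Otimes>\<^sub>M borel \<Otimes>\<^sub>M borel)"
    and bound: "\<And>x. \<bar>g x\<bar> \<le> B"
  defines "\<theta> \<equiv> \<integral>x. proj1 g x \<partial>D"
  assumes var: "(\<integral>x. (proj1 g x + proj2 g x + proj3 g x - 3 * \<theta>)\<^sup>2 \<partial>D) = \<sigma>\<^sup>2" and \<sigma>: "\<sigma> > 0"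
  shows "weak_conv_m (\<lambda>n. distr M borel (\<lambda>\<omega>. sqrt (real n) *
      ((\<Sum>i<n. \<Sum>j<n. \<Sum>m<n. g (X i \<omega>, X j \<omega>, X m \<omega>)) / real n ^ 3 - \<theta>)))
    (density lborel (normal_density 0 \<sigma>))"
proof -
  note pb = abs_proj_le[OF g bound]
  have \<theta>_bound: "\<bar>\<theta>\<bar> \<le> B" unfolding \<theta>_def by (rule D.abs_expectation_le) (use pb in auto)
  have proj_int: "integrable D (proj1 g)" "integrable D (proj2 g)" "integrable D (proj3 g)"
    by (rule D.integrable_const_bound[where B=B]; use pb in auto)+
  have \<theta>: "(\<integral>x. proj1 g x \<partial>D) = \<theta>" "(\<integral>x. proj2 g x \<partial>D) = \<theta>" "(\<integral>x. proj3 g x \<partial>D) = \<theta>"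
    using integral_proj_eq[OF g bound] by (simp_all add: \<theta>_def)
  define \<psi> where "\<psi> x = proj1 g x + proj2 g x + proj3 g x - 3 * \<theta>" for x
  have [measurable]: "\<psi> \<in> borel_measurable borel" unfolding \<psi>_def by measurable
  (* Fixing one argument of g - ... leaves minus the means of the other two projections, that is
     - 2 * \<theta>; the constant term restores mean zero. *)
  define k where "k = (\<lambda>(x, y, z). g (x, y, z) - proj1 g x - proj2 g y - proj3 g z + 2 * \<theta>)"
  have k [measurable]: "k \<in> borel_measurable (borel \<Otimes>\<^sub>M borel \<Otimes>\<^sub>M borel)"
    unfolding k_def by measurable
  have k_bound: "\<bar>k t\<bar> \<le> 6 * B" for t
  proof -
    obtain x y z where t: "t = (x, y, z)" by (cases t)
    show ?thesis
      using bound[of "(x, y, z)"] pb(1)[of x] pb(2)[of y] pb(3)[of z] \<theta>_bound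
      unfolding t k_def by simp
  qed
  have marg: "integrable (D \<Otimes>\<^sub>M D) (\<lambda>t. p (fst t))" "integrable (D \<Otimes>\<^sub>M D) (\<lambda>t. p (snd t))"
      "(\<integral>t. p (fst t) \<partial>(D \<Otimes>\<^sub>M D)) = \<theta>" "(\<integral>t. p (snd t) \<partial>(D \<Otimes>\<^sub>M D)) = \<theta>"
    if "p \<in> {proj1 g, proj2 g, proj3 g}" for p
  proof -
    have [measurable]: "p \<in> borel_measurable borel" and b: "\<bar>p x\<bar> \<le> B" and i: "(\<integral>x. p x \<partial>D) = \<theta>" for x
      using that pb \<theta> by auto
    show "integrable (D \<Otimes>\<^sub>M D) (\<lambda>t. p (fst t))" "integrable (D \<Otimes>\<^sub>M D) (\<lambda>t. p (snd t))"
      by (rule product_integrals[where B=B]; use b in simp)+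
    show "(\<integral>t. p (fst t) \<partial>(D \<Otimes>\<^sub>M D)) = \<theta>"
      by (subst product_integrals(2)[where B=B]) (use b i in \<open>simp_all add: D.prob_space[simplified]\<close>)
    show "(\<integral>t. p (snd t) \<partial>(D \<Otimes>\<^sub>M D)) = \<theta>"
      by (subst product_integrals(2)[where B=B]) (use b i in \<open>simp_all add: D.prob_space[simplified]\<close>)
  qed
  have gint: "integrable (D \<Otimes>\<^sub>M D) (\<lambda>t. g (x, fst t, snd t))"
    "integrable (D \<Otimes>\<^sub>M D) (\<lambda>t. g (fst t, x, snd t))"
    "integrable (D \<Otimes>\<^sub>M D) (\<lambda>t. g (fst t, snd t, x))" for x
    by (rule product_integrals[where B=B]; use bound in simp)+
  have deg: "(\<integral>(y, z). k (x, y, z) \<partial>(D \<Otimes>\<^sub>M D)) = 0"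
      "(\<integral>(y, z). k (y, x, z) \<partial>(D \<Otimes>\<^sub>M D)) = 0"
      "(\<integral>(y, z). k (y, z, x) \<partial>(D \<Otimes>\<^sub>M D)) = 0" for x
    using gint[of x] proj1_def[of g x] proj2_def[of g x] proj3_def[of g x]
    by (simp_all add: k_def case_prod_unfold marg DD.P.prob_space)
  let ?G = "\<lambda>n \<omega>. \<Sum>i<n. \<Sum>j<n. \<Sum>m<n. g (X i \<omega>, X j \<omega>, X m \<omega>)"
  let ?K = "\<lambda>n \<omega>. \<Sum>i<n. \<Sum>j<n. \<Sum>m<n. k (X i \<omega>, X j \<omega>, X m \<omega>)"
  define S where "S = (\<lambda>n \<omega>. (\<Sum>i<n. \<psi> (X i \<omega>)) / sqrt (real n))"
  define T where "T = (\<lambda>n \<omega>. sqrt (real n) * (?G n \<omega> / real n ^ 3 - \<theta>))"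
  have [measurable]: "S n \<in> borel_measurable M" "T n \<in> borel_measurable M" for n
    unfolding S_def T_def by measurable
  have decomp: "T n \<omega> - S n \<omega> = ?K n \<omega> / (real n ^ 2 * sqrt (real n))" for n \<omega>
  proof (cases "n = 0")
    case False
    (* Powers of n become even powers of r, so that the identity is one of rational functions. *)
    define r where "r = sqrt (real n)"
    have r: "r > 0" "real n = r\<^sup>2" using False by (auto simp: r_def)
    have "?K n \<omega> = ?G n \<omega> - real n ^ 2 * (\<Sum>i<n. \<psi> (X i \<omega>)) - \<theta> * real n ^ 3"
      unfolding k_def \<psi>_def
      by (simp add: sum.distrib sum_subtractf power2_eq_square power3_eq_cube
          algebra_simps flip: sum_distrib_left)
    moreover have "r * (G / (r\<^sup>2) ^ 3 - \<theta>) - P / r = (G - (r\<^sup>2)\<^sup>2 * P - \<theta> * (r\<^sup>2) ^ 3) / ((r\<^sup>2)\<^sup>2 * r)" for G P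
      using r(1) by (simp add: field_simps eval_nat_numeral)
    ultimately show ?thesis
      unfolding T_def S_def r_def[symmetric] by (simp only: r(2))
  qed (simp add: S_def T_def)
  have K_int: "integrable M (\<lambda>\<omega>. k (X i \<omega>, X j \<omega>, X m \<omega>))" for i j m
    by (rule integrable_const_bound[where B="6 * B"]) (use k_bound in auto)
  have "weak_conv_m (\<lambda>n. distr M borel (T n)) (density lborel (normal_density 0 \<sigma>))"
  proof (rule weak_conv_L1_perturbation)
    show "weak_conv_m (\<lambda>n. distr M borel (S n)) (density lborel (normal_density 0 \<sigma>))"
      unfolding S_def
    proof (rule normalised_sum_weak_conv)
      show "\<bar>\<psi> x\<bar> \<le> 6 * B" for x
        using pb(1)[of x] pb(2)[of x] pb(3)[of x] \<theta>_bound unfolding \<psi>_def by linarith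
      show "(\<integral>x. \<psi> x \<partial>D) = 0"
        unfolding \<psi>_def by (simp add: proj_int \<theta> D.prob_space[simplified])
      show "(\<integral>x. (\<psi> x)\<^sup>2 \<partial>D) = \<sigma>\<^sup>2" using var by (simp add: \<psi>_def)
    qed (use \<sigma> in auto)
    show "real_distribution (density lborel (normal_density 0 \<sigma>))"
      using \<sigma> by (simp add: real_distribution_def real_distribution_axioms_def prob_space_normal_density)
    show "integrable M (\<lambda>\<omega>. T n \<omega> - S n \<omega>)" for n
      unfolding decomp by (simp add: K_int)
    show "(\<lambda>n. expectation (\<lambda>\<omega>. \<bar>T n \<omega> - S n \<omega>\<bar>)) \<longlonglongrightarrow> 0"
    proof (rule Lim_null_comparison)
      show "\<forall>\<^sub>F n in sequentially. norm (expectation (\<lambda>\<omega>. \<bar>T n \<omega> - S n \<omega>\<bar>)) \<le> 54 * B * (1 / sqrt (real n))"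
        using eventually_gt_at_top[of 0]
      proof eventually_elim
        case (elim n)
        have "expectation (\<lambda>\<omega>. \<bar>T n \<omega> - S n \<omega>\<bar>) = expectation (\<lambda>\<omega>. \<bar>?K n \<omega>\<bar>) / (real n ^ 2 * sqrt (real n))"
          unfolding decomp by (simp add: abs_divide abs_mult)
        also have "\<dots> \<le> (9 * (6 * B) * (real n)\<^sup>2) / (real n ^ 2 * sqrt (real n))"
          by (intro divide_right_mono degenerate_sum_L1[OF k k_bound deg]) auto
        also have "\<dots> = 54 * B * (1 / sqrt (real n))" using elim by simp
        finally show ?case by simp
      qed
      show "(\<lambda>n. 54 * B * (1 / sqrt (real n))) \<longlonglongrightarrow> 0"
        by real_asymp
    qed
  qed simp_all
  then show ?thesis by (simp add: T_def)
qed

end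

section \<open>The uniform distribution on the unit interval\<close>

definition unif :: "real measure" where
  "unif = density lborel (indicator {0..1})"

lemma sets_unif [measurable_cong, simp]: "sets unif = sets borel"
  by (simp add: unif_def)

text \<open>
  The integrand is only evaluated on \<open>[0, 1]\<close>, which is why explicit formulas for the projections are
  needed on that interval alone.
\<close>

lemma integral_unif:
  fixes f :: "real \<Rightarrow> real"
  assumes [measurable]: "f \<in> borel_measurable borel" and bound: "\<And>x. \<bar>f x\<bar> \<le> B"
    and I: "(f has_integral I) {0..1}"
  shows "(\<integral>x. f x \<partial>unif) = I"
proof -
  have "integrable lborel (\<lambda>x. indicator {0..1::real} x * B)"
    by (intro integrable_mult_left integrable_real_indicator) auto
  then have "set_integrable lborel {0..1::real} f"
    unfolding set_integrable_def
    by (rule Bochner_Integration.integrable_bound)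
      (use bound[THEN order_trans[OF _ abs_ge_self]] in \<open>auto simp: indicator_def abs_mult\<close>)
  then have "(LINT x:{0..1}|lborel. f x) = I"
    using set_borel_integral_eq_integral(2) integral_unique[OF I] by metis
  moreover have "(\<integral>x. f x \<partial>unif) = (LINT x:{0..1}|lborel. f x)"
    unfolding unif_def set_lebesgue_integral_def
    by (subst integral_density[where g="indicator {0..1}", unfolded ennreal_indicator]) auto
  ultimately show ?thesis by simp
qed

lemma has_integral_less:
  assumes "a \<in> {0..1}"
  shows "((\<lambda>x. of_bool (x < a) :: real) has_integral a) {0..1::real}"
proof (rule has_integral_spike_finite[where S="{a}"])
  show "((\<lambda>x. if x \<in> {0..a} then 1 else 0 :: real) has_integral a) {0..1}"
    using has_integral_const_real[of "1::real" 0 a] assms by (subst has_integral_restrict) auto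
qed auto

lemma has_integral_greater:
  assumes "a \<in> {0..1}"
  shows "((\<lambda>x. of_bool (a < x) :: real) has_integral (1 - a)) {0..1::real}"
proof (rule has_integral_spike_finite[where S="{a}"])
  show "((\<lambda>x. if x \<in> {a..1} then 1 else 0 :: real) has_integral (1 - a)) {0..1}"
    using has_integral_const_real[of "1::real" a 1] assms by (subst has_integral_restrict) auto
qed auto

lemma has_integral_min:
  assumes "a \<in> {0..1}"
  shows "((\<lambda>x. min a x) has_integral (a - a\<^sup>2 / 2)) {0..1::real}"
proof -
  have "((\<lambda>x. x) has_integral (a\<^sup>2 / 2 - 0\<^sup>2 / 2)) {0..a}"
    by (rule fundamental_theorem_of_calculus)
      (use assms in \<open>auto intro!: derivative_eq_intros simp flip: has_real_derivative_iff_has_vector_derivative\<close>)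
  then have "((\<lambda>x. min a x) has_integral a\<^sup>2 / 2) {0..a}"
    by (subst has_integral_cong[where g="\<lambda>x. x"]) auto
  moreover have "((\<lambda>x. min a x) has_integral (1 - a) * a) {a..1}"
    using has_integral_const_real[of a a 1] assms
    by (subst has_integral_cong[where g="\<lambda>x. a"]) auto
  ultimately have "((\<lambda>x. min a x) has_integral (a\<^sup>2 / 2 + (1 - a) * a)) {0..1}"
    using assms by (intro has_integral_combine) auto
  then show ?thesis by (simp add: algebra_simps power2_eq_square)
qed

lemma has_integral_sqrt: "((\<lambda>x. sqrt x) has_integral (2 / 3)) {0..1::real}"
proof -
  have "((\<lambda>x. sqrt x) has_integral (2 / 3 * 1 * sqrt 1 - 2 / 3 * 0 * sqrt 0)) {0..1::real}"
  proof (rule fundamental_theorem_of_calculus_interior)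
    fix x :: real assume "x \<in> {0<..<1}"
    then show "((\<lambda>x. 2 / 3 * x * sqrt x) has_vector_derivative sqrt x) (at x)"
      by (auto intro!: derivative_eq_intros simp: field_simps simp flip: has_real_derivative_iff_has_vector_derivative)
  qed (auto intro!: continuous_intros)
  then show ?thesis by simp
qed

lemma has_integral_identity_unit: "((\<lambda>x. x) has_integral (1 / 2)) {0..1::real}"
  using has_integral_min[of 1] by (subst has_integral_cong[where g="min 1"]) auto

section \<open>The kernel of the statistic\<close>

text \<open>
  The argument \<open>w\<close>, which comes from the point at which the two distribution functions are compared,
  is listed first in agreement with the outermost sum of the statistic.
\<close>

definition kern :: "real \<times> real \<times> real \<Rightarrow> real" where
  "kern = (\<lambda>(w, u, v). of_bool (w < min u v) - of_bool (w < u * sqrt v))"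

lemma kern_measurable [measurable]: "kern \<in> borel_measurable (borel \<Otimes>\<^sub>M borel \<Otimes>\<^sub>M borel)"
  unfolding kern_def of_bool_def by measurable

lemma abs_kern_le: "\<bar>kern t\<bar> \<le> 1"
  by (simp add: kern_def split: prod.split)

lemma integral_kern_first:
  assumes "u \<in> {0..1}" "v \<in> {0..1}"
  shows "(\<integral>w. kern (w, u, v) \<partial>unif) = min u v - u * sqrt v"
proof (rule integral_unif[where B=1])
  have "u * sqrt v \<le> 1 * 1" using assms by (intro mult_mono) auto
  then show "((\<lambda>w. kern (w, u, v)) has_integral (min u v - u * sqrt v)) {0..1}"
    unfolding kern_def prod.case using assms
    by (intro has_integral_diff has_integral_less) auto
qed (use abs_kern_le in auto)

text \<open>
  For \<open>w < u\<close> the two indicators are those of \<open>w < v\<close> and \<open>(w / u)\<^sup>2 < v\<close>; for \<open>u \<le> w\<close> both vanish, as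
  \<open>u * sqrt v \<le> u\<close>. Integrating over \<open>v\<close> first avoids square roots.
\<close>

lemma integral_kern_third:
  assumes "w \<in> {0..1}" "u \<in> {0..1}"
  shows "(\<integral>v. kern (w, u, v) \<partial>unif) = (if w < u then w\<^sup>2 / u\<^sup>2 - w else 0)"
proof (cases "w < u")
  case True
  have r: "w / u \<in> {0..1}" using True assms by auto
  have "kern (w, u, v) = of_bool (w < v) - of_bool ((w / u)\<^sup>2 < v)" if "v \<in> {0..1}" for v
  proof -
    have "w < u * sqrt v \<longleftrightarrow> w / u < sqrt v"
      using True assms by (simp add: field_simps)
    also have "w / u = sqrt ((w / u)\<^sup>2)" using r by (intro real_sqrt_unique[symmetric]) auto
    finally have "w < u * sqrt v \<longleftrightarrow> (w / u)\<^sup>2 < v" by (simp only: real_sqrt_less_iff)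
    then show ?thesis using True by (simp add: kern_def)
  qed
  moreover have "((\<lambda>v. of_bool (w < v) - of_bool ((w / u)\<^sup>2 < v) :: real) has_integral
      ((1 - w) - (1 - (w / u)\<^sup>2))) {0..1}"
    using assms r by (intro has_integral_diff has_integral_greater) (auto simp: power_le_one)
  ultimately have "((\<lambda>v. kern (w, u, v)) has_integral ((1 - w) - (1 - (w / u)\<^sup>2))) {0..1}"
    by (subst has_integral_cong) auto
  then show ?thesis
    using True by (subst integral_unif[where B=1]) (auto simp: abs_kern_le power_divide)
next
  case False
  have "kern (w, u, v) = 0" if "v \<in> {0..1}" for v
  proof -
    have "u * sqrt v \<le> u * 1" using that assms by (intro mult_left_mono) auto
    then show ?thesis using False by (simp add: kern_def)
  qed
  then have "((\<lambda>v. kern (w, u, v)) has_integral 0) {0..1}"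
    by (subst has_integral_cong[where g="\<lambda>_. 0"]) auto
  then show ?thesis
    using False by (subst integral_unif[where B=1]) (auto simp: abs_kern_le)
qed

text \<open>
  On \<open>[w, 1]\<close> the positive part \<open>w\<^sup>2 * (1 / w - 1)\<close> cancels \<open>w * (1 - w)\<close>. This is the analytic form
  of the equality in law of \<open>max a b\<close> and \<open>a + b / 2\<close>.
\<close>

lemma has_integral_kern_tail:
  assumes "w \<in> {0..1}"
  shows "((\<lambda>u. if w < u then w\<^sup>2 / u\<^sup>2 - w else 0) has_integral 0) {0..1::real}"
proof (cases "w = 0")
  case False
  then have w: "0 < w" "w \<le> 1" using assms by auto
  have "((\<lambda>u. w\<^sup>2 / u\<^sup>2 - w) has_integral ((- w\<^sup>2 / 1 - w * 1) - (- w\<^sup>2 / w - w * w))) {w..1}"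
  proof (rule fundamental_theorem_of_calculus)
    fix x assume "x \<in> {w..1}"
    then have "x > 0" using w by auto
    then show "((\<lambda>u. - w\<^sup>2 / u - w * u) has_vector_derivative w\<^sup>2 / x\<^sup>2 - w) (at x within {w..1})"
      by (auto intro!: derivative_eq_intros simp: field_simps power2_eq_square
          simp flip: has_real_derivative_iff_has_vector_derivative)
  qed (use w in auto)
  then have "((\<lambda>u. w\<^sup>2 / u\<^sup>2 - w) has_integral 0) {w..1}"
    using w by (simp add: power2_eq_square)
  then have *: "((\<lambda>u. if u \<in> {w..1} then w\<^sup>2 / u\<^sup>2 - w else 0) has_integral 0) {0..1}"
    using w by (subst has_integral_restrict) auto
  show ?thesis
    by (rule has_integral_spike_finite[where S="{w}", OF _ _ *]) auto
next
  case True
  then show ?thesis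
    by (subst has_integral_cong[where g="\<lambda>_. 0"]) auto
qed

text \<open>
  The integral is the variance of the sum of the projections of the kernel. The antiderivative comes
  from expanding the square.
\<close>

lemma has_integral_psi_square:
  "((\<lambda>u. (4 / 3 * u - u\<^sup>2 - sqrt u / 2)\<^sup>2) has_integral (5 / 1512)) {0..1::real}"
proof -
  define F :: "real \<Rightarrow> real" where "F = (\<lambda>u. 16 / 27 * u ^ 3 + u ^ 5 / 5 + u\<^sup>2 / 8 - 2 / 3 * u ^ 4
    - 8 / 15 * (u\<^sup>2 * sqrt u) + 2 / 7 * (u ^ 3 * sqrt u))"
  have "((\<lambda>u. (4 / 3 * u - u\<^sup>2 - sqrt u / 2)\<^sup>2) has_integral (F 1 - F 0)) {0..1::real}"
  proof (rule fundamental_theorem_of_calculus_interior)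
    fix x :: real assume "x \<in> {0<..<1}"
    define s where "s = sqrt x"
    have s: "s > 0" "x = s\<^sup>2" using \<open>x \<in> _\<close> by (auto simp: s_def)
    have "(F has_real_derivative (4 / 3 * x - x\<^sup>2 - s / 2)\<^sup>2) (at x)"
      unfolding F_def
      apply (rule derivative_eq_intros refl | use \<open>x \<in> _\<close> in force)+
      unfolding s_def[symmetric] using s(1)
      by (simp add: s(2) field_simps eval_nat_numeral)
    then show "(F has_vector_derivative (4 / 3 * x - x\<^sup>2 - sqrt x / 2)\<^sup>2) (at x)"
      by (simp add: s_def flip: has_real_derivative_iff_has_vector_derivative)
  qed (auto intro!: continuous_intros simp: F_def)
  then show ?thesis by (simp add: F_def)
qed

text \<open>
  The two halves of \<open>G2\<close> coincide after exchanging the summation indices, so a kernel that is not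
  symmetric in its last two arguments suffices.
\<close>

lemma I2_eq_V_statistic:
  assumes "l > 0"
  defines "U \<equiv> \<lambda>x. exp (- l * x)"
  shows "I2 n x = (\<Sum>m<n. \<Sum>i<n. \<Sum>j<n. kern (U (x m), U (x i), U (x j))) / real n ^ 3"
proof -
  have less: "U c < U a \<longleftrightarrow> a < c" for a c
    using assms by (auto simp: U_def)
  have half: "U c < U a * sqrt (U b) \<longleftrightarrow> a + b / 2 < c" for a b c
  proof -
    have "sqrt (U b) = exp (- l * (b / 2))"
      by (rule real_sqrt_unique) (auto simp: U_def power2_eq_square simp flip: exp_add)
    then have "U a * sqrt (U b) = U (a + b / 2)"
      by (simp add: U_def algebra_simps flip: exp_add)
    then show ?thesis using assms by (simp add: U_def)
  qed
  have G2: "G2 n x t = 1 / (real n)\<^sup>2 * (\<Sum>i<n. \<Sum>j<n. of_bool (x i + x j / 2 < t))" for t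
  proof -
    have "(\<Sum>i<n. \<Sum>j<n. of_bool (x i / 2 + x j < t) :: real) = (\<Sum>i<n. \<Sum>j<n. of_bool (x i + x j / 2 < t))"
      by (subst sum.swap) (simp add: add.commute)
    then show ?thesis by (simp add: G2_def sum.distrib)
  qed
  have "H2 n x t - G2 n x t = (\<Sum>i<n. \<Sum>j<n. kern (U t, U (x i), U (x j))) / (real n)\<^sup>2" for t
    by (simp add: H2_def G2 kern_def less half sum_subtractf diff_divide_distrib)
  then show ?thesis
    by (simp add: I2_def power3_eq_cube power2_eq_square flip: sum_divide_distrib)
qed

lemma (in prob_space) exponential_to_unif:
  assumes D: "distributed M lborel X (exponential_density l)" and l: "l > 0"
  shows "distr M borel (\<lambda>\<omega>. exp (- l * X \<omega>)) = unif"
proof -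
  have [measurable]: "X \<in> borel_measurable M" using distributed_measurable[OF D] by simp
  have "distributed M lborel (\<lambda>\<omega>. exp (- l * X \<omega>)) (\<lambda>x. indicator {0..1} x / measure lborel {0..1::real})"
  proof (rule uniform_distrI_borel_atLeastAtMost)
    fix t :: real assume t: "0 \<le> t" "t \<le> 1"
    show "\<P>(\<omega> in M. exp (- l * X \<omega>) \<le> t) = (t - 0) / (1 - 0)"
    proof (cases "t = 0")
      case True
      then show ?thesis by simp
    next
      case False
      define a where "a = - ln t / l"
      have "t > 0" using False t by simp
      then have a: "0 \<le> a" "t = exp (- a * l)"
        using False t l by (auto simp: a_def intro!: divide_nonpos_pos)
      have "\<P>(\<omega> in M. exp (- l * X \<omega>) \<le> t) = \<P>(\<omega> in M. a \<le> X \<omega>)"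
        using l by (simp add: a(2) mult.commute)
      also have "\<dots> = \<P>(\<omega> in M. a < X \<omega>)"
      proof (rule prob_eq_AE)
        have "AE x in lborel. x \<noteq> a" by (rule AE_lborel_singleton)
        then have "AE \<omega> in M. X \<omega> \<noteq> a"
          using distributed_AE2[OF D, of "\<lambda>x. x \<noteq> a"] by auto
        then show "AE \<omega> in M. a \<le> X \<omega> \<longleftrightarrow> a < X \<omega>" by eventually_elim auto
      qed auto
      also have "\<dots> = t" using exponential_distributedD_gt[OF D a(1) l] by (simp add: a(2))
      finally show ?thesis by simp
    qed
  qed auto
  then have "distr M lborel (\<lambda>\<omega>. exp (- l * X \<omega>)) = unif"
    unfolding distributed_def unif_def by (simp add: ennreal_indicator)
  then show ?thesis by (metis distr_cong sets_lborel)
qed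

section \<open>Asymptotic normality of the statistic\<close>

theorem mainTheorem6:
  fixes M :: "'a measure" and X :: "nat \<Rightarrow> 'a \<Rightarrow> real" and l :: real
  assumes "prob_space M"
    and "l > 0"
    and "prob_space.indep_vars M (\<lambda>_. borel) X UNIV"
    and "\<And>i. distributed M lborel (X i) (exponential_density l)"
  shows "weak_conv_m
    (\<lambda>n. distr M borel (\<lambda>\<omega>. sqrt (real n) * I2 n (\<lambda>i. X i \<omega>)))
    (density lborel (normal_density 0 (sqrt (5 / 1512))))"
proof -
  interpret M: prob_space M by fact
  define U where "U = (\<lambda>i \<omega>. exp (- l * X i \<omega>))"
  interpret iid_sample M U unif
  proof
    show "M.indep_vars (\<lambda>_. borel) U UNIV"
      unfolding U_def by (rule M.indep_vars_compose2[OF assms(3)]) simp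
    show "distr M borel (U i) = unif" for i
      unfolding U_def by (rule M.exponential_to_unif) fact+
  qed
  note kern = kern_measurable abs_kern_le
  have pb: "\<bar>proj1 kern x\<bar> \<le> 1" "\<bar>proj2 kern x\<bar> \<le> 1" "\<bar>proj3 kern x\<bar> \<le> 1" for x
    by (rule abs_proj_le[OF kern])+
  have p1: "proj1 kern w = 0" if "w \<in> {0..1}" for w
  proof -
    have "proj1 kern w = (\<integral>u. \<integral>v. kern (w, u, v) \<partial>unif \<partial>unif)"
      unfolding proj1_def by (subst product_integrals(2)[where B=1]) (auto simp: abs_kern_le)
    also have "\<dots> = 0"
    proof (rule integral_unif)
      show "\<bar>\<integral>v. kern (w, u, v) \<partial>unif\<bar> \<le> 1" for u
        by (rule D.abs_expectation_le) (auto simp: abs_kern_le)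
      show "((\<lambda>u. \<integral>v. kern (w, u, v) \<partial>unif) has_integral 0) {0..1}"
        using has_integral_kern_tail[OF that]
        by (rule has_integral_cong[THEN iffD1, rotated]) (use that integral_kern_third in auto)
    qed simp
    finally show ?thesis .
  qed
  have p2: "proj2 kern u = u / 3 - u\<^sup>2 / 2" if "u \<in> {0..1}" for u
  proof -
    have "proj2 kern u = (\<integral>v. \<integral>w. kern (w, u, v) \<partial>unif \<partial>unif)"
      unfolding proj2_def by (subst product_integrals(3)[where B=1]) (auto simp: abs_kern_le)
    also have "\<dots> = u - u\<^sup>2 / 2 - u * (2 / 3)"
    proof (rule integral_unif)
      show "\<bar>\<integral>w. kern (w, u, v) \<partial>unif\<bar> \<le> 1" for v
        by (rule D.abs_expectation_le) (auto simp: abs_kern_le)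
      have "((\<lambda>v. min u v - u * sqrt v) has_integral (u - u\<^sup>2 / 2 - u * (2 / 3))) {0..1}"
        using that by (intro has_integral_diff has_integral_min has_integral_mult_right has_integral_sqrt)
      then show "((\<lambda>v. \<integral>w. kern (w, u, v) \<partial>unif) has_integral (u - u\<^sup>2 / 2 - u * (2 / 3))) {0..1}"
        by (rule has_integral_cong[THEN iffD1, rotated]) (use that integral_kern_first in auto)
    qed simp
    finally show ?thesis by simp
  qed
  have p3: "proj3 kern v = v - v\<^sup>2 / 2 - sqrt v / 2" if "v \<in> {0..1}" for v
  proof -
    have "proj3 kern v = (\<integral>u. \<integral>w. kern (w, u, v) \<partial>unif \<partial>unif)"
      unfolding proj3_def by (subst product_integrals(3)[where B=1]) (auto simp: abs_kern_le)
    also have "\<dots> = v - v\<^sup>2 / 2 - 1 / 2 * sqrt v"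
    proof (rule integral_unif)
      show "\<bar>\<integral>w. kern (w, u, v) \<partial>unif\<bar> \<le> 1" for u
        by (rule D.abs_expectation_le) (auto simp: abs_kern_le)
      have "((\<lambda>u. min v u - u * sqrt v) has_integral (v - v\<^sup>2 / 2 - 1 / 2 * sqrt v)) {0..1}"
        using that by (intro has_integral_diff has_integral_min has_integral_mult_left has_integral_identity_unit)
      then show "((\<lambda>u. \<integral>w. kern (w, u, v) \<partial>unif) has_integral (v - v\<^sup>2 / 2 - 1 / 2 * sqrt v)) {0..1}"
        by (rule has_integral_cong[THEN iffD1, rotated])
          (use that integral_kern_first in \<open>auto simp: min.commute\<close>)
    qed simp
    finally show ?thesis by simp
  qed
  have \<theta>: "(\<integral>w. proj1 kern w \<partial>unif) = 0"
  proof (rule integral_unif[OF _ pb(1)])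
    show "(proj1 kern has_integral 0) {0..1}"
      by (subst has_integral_cong[where g="\<lambda>_. 0"]) (auto simp: p1)
  qed simp
  have var: "(\<integral>x. (proj1 kern x + proj2 kern x + proj3 kern x - 3 * (\<integral>w. proj1 kern w \<partial>unif))\<^sup>2 \<partial>unif) = (sqrt (5 / 1512))\<^sup>2"
  proof (rule integral_unif)
    show "\<bar>(proj1 kern x + proj2 kern x + proj3 kern x - 3 * (\<integral>w. proj1 kern w \<partial>unif))\<^sup>2\<bar> \<le> 3\<^sup>2" for x
      using pb[of x] unfolding \<theta> abs_power2 by (intro power2_le_iff_abs_le[THEN iffD2]) auto
    have "((\<lambda>u. (4 / 3 * u - u\<^sup>2 - sqrt u / 2)\<^sup>2) has_integral (sqrt (5 / 1512))\<^sup>2) {0..1}"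
      using has_integral_psi_square by simp
    then show "((\<lambda>x. (proj1 kern x + proj2 kern x + proj3 kern x - 3 * (\<integral>w. proj1 kern w \<partial>unif))\<^sup>2)
        has_integral (sqrt (5 / 1512))\<^sup>2) {0..1}"
      by (rule has_integral_cong[THEN iffD1, rotated]) (simp add: p1 p2 p3 \<theta> algebra_simps)
  qed simp
  show ?thesis
    using V_statistic_weak_conv[OF kern var] \<theta>
    by (simp add: I2_eq_V_statistic[OF assms(2)] U_def)
qed

end
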